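(* For every $n\ge 0$, $$\mathrm{Sp}\left(M_1^{(n)}\right)=\mathrm{Sp}\left(\frac14\sum_{j=0}^{1}\left(a_j^{(n)}+a_j^{(n)*}\right)\right)=\{1\}\cup\left\{\cos\left(\tfrac{p}{q}\pi\right)\ :\ p,q\in\mathbb N,\ 1\le p<q\le n+1\right\}.$$ If $p$ and $q$ (with $1\le p<q\le n+1$) are mutually prime, then the multiplicity of the eigenvalue $\cos\left(pq^{-1}\pi\right)$ of $M_1^{(n)}$, denoted by $m_{p,q}^{(n;1)}$, is given by $$m_{p,q}^{(n;1)}=\left[2^n\left(\frac{2^{-q}-2^{-q\left(\left[\frac{n}{q}\right]+1\right)}}{1-2^{-q}}\right)\right].$$
   Context: The real $2^n\times2^n$ matrices $a_0^{(n)},a_1^{(n)}$ (describing the action of the box-ball system with carrier capacity $1$, the "BBS translation", on binary words of length $n$) are defined by $a_0^{(0)}=a_1^{(0)}=1$ and $$a_0^{(n+1)}=\begin{pmatrix} a_0^{(n)} & a_1^{(n)}\\ 0&0\end{pmatrix},\qquad a_1^{(n+1)}=\begin{pmatrix} 0&0\\ a_0^{(n)} & a_1^{(n)}\end{pmatrix};$$ $*$ denotes the transpose, and the transition operator is $M_1^{(n)}=\frac14\left(a_0^{(n)}+a_0^{(n)*}+a_1^{(n)}+a_1^{(n)*}\right)$. $\mathrm{Sp}$ denotes the set of eigenvalues. Both square brackets $[x]$ in the multiplicity formula denote the integer nearest to $x$, with half-integers rounded up. *)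

theory Defs
  imports Complex_Main "Jordan_Normal_Form.Spectral_Radius"
begin

fun bbs_a0 :: "nat \<Rightarrow> real mat" and bbs_a1 :: "nat \<Rightarrow> real mat" where
  "bbs_a0 0 = 1\<^sub>m 1"
| "bbs_a1 0 = 1\<^sub>m 1"
| "bbs_a0 (Suc n) = four_block_mat (bbs_a0 n) (bbs_a1 n) (0\<^sub>m (2 ^ n) (2 ^ n)) (0\<^sub>m (2 ^ n) (2 ^ n))"
| "bbs_a1 (Suc n) = four_block_mat (0\<^sub>m (2 ^ n) (2 ^ n)) (0\<^sub>m (2 ^ n) (2 ^ n)) (bbs_a0 n) (bbs_a1 n)"

definition M1 :: "nat \<Rightarrow> real mat" where
  "M1 n = (1/4) \<cdot>\<^sub>m (bbs_a0 n + transpose_mat (bbs_a0 n) + bbs_a1 n + transpose_mat (bbs_a1 n))"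

(* All complex eigenvalues of a real matrix, so that the spectrum being real is part of any
   claim about Sp and not built into the definition. *)
definition Sp :: "real mat \<Rightarrow> complex set" where
  "Sp A = spectrum (map_mat complex_of_real A)"

(* Algebraic multiplicity; for the symmetric matrices M1 n it is also the dimension of the
   eigenspace. *)
definition eigenvalue_mult :: "real mat \<Rightarrow> real \<Rightarrow> nat" where
  "eigenvalue_mult A x = order x (char_poly A)"

end

theory Submission
  imports Defs "HOL-Library.Discrete_Functions"
begin

text \<open>
  For \<open>n \<ge> 1\<close> the matrix \<open>bbs_a0 n + bbs_a1 n\<close> sends the basis vector of a word \<open>y\<^sub>1 \<dots> y\<^sub>n\<close> to the sum of the
  basis vectors of \<open>x y\<^sub>1 \<dots> y\<^sub>n\<^sub>-\<^sub>1\<close> over both letters \<open>x\<close>: it is the adjacency matrix of a de Bruijn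
  graph. The last letter is summed out and a uniform letter is put in front, so in the tensor power
  of the basis (sum of the two letters, difference of the two letters) it becomes, up to the
  factor 2, a partial shift: a word ending with the digit 0 (sum) loses this digit and gains a
  leading 0, and a word ending with 1 (difference) is killed. On the numbers below \<open>2 ^ n\<close> that
  these binary words write, this is \<open>2 * i \<mapsto> i\<close>. The change of basis is the Hadamard matrix,
  and it makes \<open>M1 n\<close> similar to half of the adjacency matrix of the graph on
  \<open>{0..<2 ^ n}\<close> with the edges \<open>{i, 2 * i}\<close>, in which the loop at 0 has weight 1
  (\<open>M1_similar\<close>).

  Apart from 0, which gives the eigenvalue 1, this graph is a union of paths
  \<open>m, 2 * m, 4 * m, \<dots>\<close> with \<open>m\<close> odd. A path with \<open>k\<close> vertices contributes \<open>path_poly k\<close>, the monic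
  Chebyshev polynomial of the second kind and of degree \<open>k\<close>, whose roots are the simple roots
  \<open>cos (j * pi / (k + 1))\<close> with \<open>1 \<le> j \<le> k\<close>. For \<open>n \<ge> 1\<close> there is one path with \<open>n\<close> vertices, and
  \<open>2 ^ (n - 1 - k)\<close> of them have \<open>k\<close> vertices for \<open>1 \<le> k < n\<close>, whence
  \<open>char_poly_M1\<close>. Instead of sorting the vertices into paths, the proof eliminates the vertices from
  the large ends of all paths at once: the pivots are quotients of consecutive path polynomials,
  depend only on the binary length of the vertex, and their product telescopes.

  If \<open>p\<close> and \<open>q\<close> are coprime, \<open>cos (p * pi / q)\<close> is a root of \<open>path_poly k\<close> exactly if
  \<open>q\<close> divides \<open>k + 1\<close>. The multiplicity is therefore the number of paths for which \<open>q\<close> divides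
  one more than the number of vertices. The paths with fewer than \<open>n\<close> vertices give
  \<open>(2 ^ n - 2 ^ (n mod q)) / (2 ^ q - 1)\<close>, and the longest one gives 1 if \<open>q\<close> divides \<open>n + 1\<close>. The
  expression in the theorem exceeds the first number by less than a half, unless
  \<open>q\<close> divides \<open>n + 1\<close>, when it exceeds it by exactly a half and is rounded up
  (\<open>round_chain_count\<close>).
\<close>

section \<open>From the de Bruijn graph to the doubling graph\<close>

fun hadamard :: "nat \<Rightarrow> real mat" where
  "hadamard 0 = 1\<^sub>m 1"
| "hadamard (Suc n) = four_block_mat (hadamard n) (hadamard n) (hadamard n) (- hadamard n)"

lemma hadamard_carrier [simp]: "hadamard n \<in> carrier_mat (2 ^ n) (2 ^ n)"
  by (induction n) (auto simp: mult_2)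

lemma bbs_carrier [simp]:
  "bbs_a0 n \<in> carrier_mat (2 ^ n) (2 ^ n)" "bbs_a1 n \<in> carrier_mat (2 ^ n) (2 ^ n)"
  by (induction n) (auto simp: mult_2)

lemma transpose_hadamard [simp]: "transpose_mat (hadamard n) = hadamard n"
  by (induction n)
    (auto simp: transpose_four_block_mat[OF hadamard_carrier hadamard_carrier hadamard_carrier] transpose_uminus)

lemma hadamard_block_mult:
  fixes P :: "real mat"
  assumes "P \<in> carrier_mat N N" "A \<in> carrier_mat N N" "B \<in> carrier_mat N N"
    "C \<in> carrier_mat N N" "D \<in> carrier_mat N N"
  shows "four_block_mat P P P (- P) * four_block_mat A B C D =
      four_block_mat (P * (A + C)) (P * (B + D)) (P * (A - C)) (P * (B - D))"
    and "four_block_mat A B C D * four_block_mat P P P (- P) =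
      four_block_mat ((A + B) * P) ((A - B) * P) ((C + D) * P) ((C - D) * P)"
proof -
  have mP: "- P \<in> carrier_mat N N" using assms by simp
  show "four_block_mat P P P (- P) * four_block_mat A B C D =
      four_block_mat (P * (A + C)) (P * (B + D)) (P * (A - C)) (P * (B - D))"
    unfolding mult_four_block_mat[OF assms(1,1,1) mP assms(2-5)]
    using assms by (intro cong_four_block_mat) (auto simp: mult_add_distrib_mat mult_minus_distrib_mat add_uminus_minus_mat)
  show "four_block_mat A B C D * four_block_mat P P P (- P) =
      four_block_mat ((A + B) * P) ((A - B) * P) ((C + D) * P) ((C - D) * P)"
    unfolding mult_four_block_mat[OF assms(2-5) assms(1,1,1) mP]
    using assms by (intro cong_four_block_mat) (auto simp: add_mult_distrib_mat minus_mult_distrib_mat add_uminus_minus_mat)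
qed

lemma smult_smult_mat: "k \<cdot>\<^sub>m (l \<cdot>\<^sub>m A) = (k * l) \<cdot>\<^sub>m (A :: real mat)"
  by (rule eq_matI) auto

lemma hadamard_square: "hadamard n * hadamard n = 2 ^ n \<cdot>\<^sub>m 1\<^sub>m (2 ^ n)"
proof (induction n)
  case 0
  show ?case by (auto intro!: eq_matI)
next
  case (Suc n)
  let ?P = "hadamard n"
  note P = hadamard_carrier[of n]
  have "hadamard (Suc n) * hadamard (Suc n) =
      four_block_mat (?P * (?P + ?P)) (?P * (?P + - ?P)) (?P * (?P - ?P)) (?P * (?P - - ?P))"
    using P by (simp add: hadamard_block_mult(1)[of _ "2 ^ n"])
  also have "\<dots> = four_block_mat (2 ^ Suc n \<cdot>\<^sub>m 1\<^sub>m (2 ^ n)) (0\<^sub>m (2 ^ n) (2 ^ n))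
      (0\<^sub>m (2 ^ n) (2 ^ n)) (2 ^ Suc n \<cdot>\<^sub>m 1\<^sub>m (2 ^ n))"
  proof (intro cong_four_block_mat)
    have 1: "?P - - ?P = ?P + ?P" "?P + - ?P = 0\<^sub>m (2 ^ n) (2 ^ n)" "?P - ?P = 0\<^sub>m (2 ^ n) (2 ^ n)"
      using carrier_matD[OF P] by (auto intro!: eq_matI)
    have 2: "?P * (?P + ?P) = 2 ^ Suc n \<cdot>\<^sub>m 1\<^sub>m (2 ^ n)"
      unfolding mult_add_distrib_mat[OF P P P] Suc by (auto intro!: eq_matI)
    show "?P * (?P + ?P) = 2 ^ Suc n \<cdot>\<^sub>m 1\<^sub>m (2 ^ n)" "?P * (?P - - ?P) = 2 ^ Suc n \<cdot>\<^sub>m 1\<^sub>m (2 ^ n)"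
      "?P * (?P + - ?P) = 0\<^sub>m (2 ^ n) (2 ^ n)" "?P * (?P - ?P) = 0\<^sub>m (2 ^ n) (2 ^ n)"
      unfolding 1 using 2 right_mult_zero_mat[OF P] by auto
  qed
  also have "\<dots> = 2 ^ Suc n \<cdot>\<^sub>m 1\<^sub>m (2 ^ Suc n)"
    by (rule eq_matI) auto
  finally show ?case .
qed

definition doubling_mat :: "nat \<Rightarrow> real mat" where
  "doubling_mat N = mat N N (\<lambda>(i, j). if j = 2 * i then 1 else 0)"

text \<open>
  For \<open>N = 2 ^ n\<close> with \<open>n \<ge> 1\<close> and row indices read as binary words of length \<open>n\<close>, both matrices
  drop the leading digit and append 0 at the end: \<open>doubling_mat\<close> acts on the words with leading
  digit 0, and \<open>wrapped_doubling_mat\<close> on those with leading digit 1.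
\<close>

definition wrapped_doubling_mat :: "nat \<Rightarrow> real mat" where
  "wrapped_doubling_mat N = mat N N (\<lambda>(i, j). if j + N = 2 * i then 1 else 0)"

lemma doubling_carrier [simp]:
  "doubling_mat N \<in> carrier_mat N N" "wrapped_doubling_mat N \<in> carrier_mat N N"
  by (auto simp: doubling_mat_def wrapped_doubling_mat_def)

lemma doubling_mat_blocks:
  "doubling_mat (2 * N) + wrapped_doubling_mat (2 * N) =
     four_block_mat (doubling_mat N) (wrapped_doubling_mat N) (doubling_mat N) (wrapped_doubling_mat N)"
  "doubling_mat (2 * N) - wrapped_doubling_mat (2 * N) =
     four_block_mat (doubling_mat N) (wrapped_doubling_mat N) (- doubling_mat N) (- wrapped_doubling_mat N)"
  by (rule eq_matI; auto simp: doubling_mat_def wrapped_doubling_mat_def)+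

text \<open>
  The recursion for \<open>bbs_a0\<close> and \<open>bbs_a1\<close> uses both matrices, so the image of their sum
  under the change of basis cannot be computed without that of their difference. Half of the
  sum becomes the map \<open>2 * i \<mapsto> i\<close>, and half of the difference becomes
  \<open>wrapped_doubling_mat\<close>.
\<close>

lemma hadamard_intertwines:
  "hadamard n * bbs_a0 n = (doubling_mat (2 ^ n) + wrapped_doubling_mat (2 ^ n)) * hadamard n"
  "hadamard n * bbs_a1 n = (doubling_mat (2 ^ n) - wrapped_doubling_mat (2 ^ n)) * hadamard n"
proof (induction n)
  case 0
  { case 1 show ?case by (rule eq_matI) (auto simp: doubling_mat_def wrapped_doubling_mat_def scalar_prod_def) }
  { case 2 show ?case by (rule eq_matI) (auto simp: doubling_mat_def wrapped_doubling_mat_def scalar_prod_def) }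
next
  case (Suc n)
  let ?P = "hadamard n" and ?a = "bbs_a0 n" and ?b = "bbs_a1 n"
  let ?T = "doubling_mat (2 ^ n)" and ?S = "wrapped_doubling_mat (2 ^ n)"
  have c: "?P \<in> carrier_mat (2 ^ n) (2 ^ n)" "?a \<in> carrier_mat (2 ^ n) (2 ^ n)"
    "?b \<in> carrier_mat (2 ^ n) (2 ^ n)" "?T \<in> carrier_mat (2 ^ n) (2 ^ n)"
    "?S \<in> carrier_mat (2 ^ n) (2 ^ n)"
    by auto
  have m: "- A + - B = - (A + B)" "- A - - B = - (A - B)" "0\<^sub>m (2 ^ n) (2 ^ n) - A = - A"
    if "A \<in> carrier_mat (2 ^ n) (2 ^ n)" "B \<in> carrier_mat (2 ^ n) (2 ^ n)" for A B :: "real mat"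
    using that[THEN carrier_matD(1)] that[THEN carrier_matD(2)] by (auto intro!: eq_matI)
  have mm: "- (?T + ?S) * ?P = - ((?T + ?S) * ?P)" "- (?T - ?S) * ?P = - ((?T - ?S) * ?P)"
    "?P * - ?a = - (?P * ?a)" "?P * - ?b = - (?P * ?b)"
    using c[THEN carrier_matD(1)] c[THEN carrier_matD(2)] by auto
  have sub0: "A - 0\<^sub>m (2 ^ n) (2 ^ n) = A" if "A \<in> carrier_mat (2 ^ n) (2 ^ n)" for A :: "real mat"
    using that by (auto intro!: eq_matI)
  { case 1 show ?case
      using c Suc sub0 by (simp add: hadamard_block_mult[of _ "2 ^ n"] doubling_mat_blocks) }
  { case 2 show ?case
      using c Suc by (simp add: hadamard_block_mult[of _ "2 ^ n"] doubling_mat_blocks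
          m[of _ ?S] m(3)[OF _ c(1)] mm) }
qed

text \<open>
  The path components have edges of weight \<open>1/2\<close>. At 0 the two summands coincide, which makes
  the weight of the loop 1.
\<close>

definition half_doubling_graph :: "nat \<Rightarrow> real mat" where
  "half_doubling_graph N = (1/2) \<cdot>\<^sub>m (doubling_mat N + transpose_mat (doubling_mat N))"

lemma half_doubling_carrier [simp]: "half_doubling_graph N \<in> carrier_mat N N"
  by (simp add: half_doubling_graph_def)

lemma M1_carrier [simp]: "M1 n \<in> carrier_mat (2 ^ n) (2 ^ n)"
  by (simp add: M1_def)

text \<open>
  Since the Hadamard matrix is symmetric and its square is scalar, conjugation with it commutes with
  transposition, so it suffices to conjugate \<open>bbs_a0 n + bbs_a1 n\<close>.
\<close>

lemma M1_similar: "similar_mat (M1 n) (half_doubling_graph (2 ^ n))"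
proof -
  let ?N = "2 ^ n :: nat"
  let ?P = "hadamard n" and ?a = "bbs_a0 n" and ?b = "bbs_a1 n" and ?G = "half_doubling_graph (2 ^ n)"
  let ?T = "doubling_mat (2 ^ n)" and ?S = "wrapped_doubling_mat (2 ^ n)"
  let ?A = "?a + ?b"
  have c: "?P \<in> carrier_mat ?N ?N" "?a \<in> carrier_mat ?N ?N"
    "?b \<in> carrier_mat ?N ?N" "?T \<in> carrier_mat ?N ?N"
    "?S \<in> carrier_mat ?N ?N" "?A \<in> carrier_mat ?N ?N" "?G \<in> carrier_mat ?N ?N" "M1 n \<in> carrier_mat ?N ?N"
    by auto
  note [simp] = mult_carrier_mat[of _ ?N ?N _ ?N] left_mult_one_mat[of _ ?N ?N] right_mult_one_mat[of _ ?N ?N]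
    smult_smult_mat
  note smult_out = mult_smult_distrib[of _ ?N ?N _ ?N] mult_smult_assoc_mat[of _ ?N ?N _ ?N]
  note assoc = assoc_mult_mat[of _ ?N ?N _ ?N _ ?N]
  have "?P * ?A = (?T + ?S) * ?P + (?T - ?S) * ?P"
    using c by (simp add: mult_add_distrib_mat[OF c(1,2,3)] hadamard_intertwines)
  also have "\<dots> = ((?T + ?S) + (?T - ?S)) * ?P"
    using c by (subst add_mult_distrib_mat[of "?T + ?S" ?N ?N "?T - ?S" ?P ?N]) (auto intro: minus_carrier_mat)
  also have "(?T + ?S) + (?T - ?S) = 2 \<cdot>\<^sub>m ?T"
    by (rule eq_matI) (auto simp: doubling_mat_def wrapped_doubling_mat_def)
  finally have PA: "?P * ?A = (2 \<cdot>\<^sub>m ?T) * ?P" .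
  have "?P * ?A * ?P = (2 \<cdot>\<^sub>m ?T) * (?P * ?P)"
    unfolding PA using c by (simp add: assoc)
  also have "\<dots> = 2 ^ Suc n \<cdot>\<^sub>m ?T"
    unfolding hadamard_square using c
    by (simp add: smult_out mult.commute)
  finally have PAP: "?P * ?A * ?P = 2 ^ Suc n \<cdot>\<^sub>m ?T" .
  then have "transpose_mat (?P * ?A * ?P) = transpose_mat (2 ^ Suc n \<cdot>\<^sub>m ?T)" by simp
  moreover have "transpose_mat (k \<cdot>\<^sub>m ?T) = k \<cdot>\<^sub>m transpose_mat ?T" for k
    by (rule eq_matI) auto
  ultimately have PATP: "?P * transpose_mat ?A * ?P = 2 ^ Suc n \<cdot>\<^sub>m transpose_mat ?T"
    using c by (simp add: transpose_mult[of _ ?N ?N _ ?N] assoc)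
  have M: "M1 n = (1/4) \<cdot>\<^sub>m (?A + transpose_mat ?A)"
    unfolding M1_def using c(2,3)[THEN carrier_matD(1)] c(2,3)[THEN carrier_matD(2)]
    by (auto intro!: eq_matI)
  have AT: "transpose_mat ?A \<in> carrier_mat ?N ?N" and AA: "?A + transpose_mat ?A \<in> carrier_mat ?N ?N"
    using c by auto
  have "?P * M1 n * ?P = (1/4) \<cdot>\<^sub>m (?P * (?A + transpose_mat ?A) * ?P)"
    unfolding M mult_smult_distrib[OF c(1) AA] mult_smult_assoc_mat[OF mult_carrier_mat[OF c(1) AA] c(1)] ..
  also have "?P * (?A + transpose_mat ?A) * ?P = ?P * ?A * ?P + ?P * transpose_mat ?A * ?P"
    unfolding mult_add_distrib_mat[OF c(1,6) AT]
    by (rule add_mult_distrib_mat[OF mult_carrier_mat[OF c(1,6)] mult_carrier_mat[OF c(1) AT] c(1)])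
  also have "(1/4) \<cdot>\<^sub>m \<dots> = 2 ^ n \<cdot>\<^sub>m ?G"
    unfolding PAP PATP half_doubling_graph_def
    using c(4)[THEN carrier_matD(1)] c(4)[THEN carrier_matD(2)]
    by (auto intro!: eq_matI simp: algebra_simps)
  finally have PMP: "?P * M1 n * ?P = 2 ^ n \<cdot>\<^sub>m ?G" .
  have "?P * (2 ^ n \<cdot>\<^sub>m ?G) * ?P = (?P * ?P) * M1 n * (?P * ?P)"
    unfolding PMP[symmetric] using c by (simp add: assoc)
  also have "\<dots> = (2 ^ n * 2 ^ n) \<cdot>\<^sub>m M1 n"
    unfolding hadamard_square using c
    by (simp add: smult_out)
  finally have *: "?P * (2 ^ n \<cdot>\<^sub>m ?G) * ?P = (2 ^ n * 2 ^ n) \<cdot>\<^sub>m M1 n" .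
  have "((1 / 2 ^ n) \<cdot>\<^sub>m ?P) * ?G * ?P = (1 / (2 ^ n * 2 ^ n)) \<cdot>\<^sub>m (?P * (2 ^ n \<cdot>\<^sub>m ?G) * ?P)"
    using c by (simp add: smult_out)
  also have "\<dots> = M1 n"
    unfolding * by (rule eq_matI) auto
  finally have "M1 n = ((1 / 2 ^ n) \<cdot>\<^sub>m ?P) * ?G * ?P" by (rule sym)
  moreover have "1 \<cdot>\<^sub>m X = X" for X :: "real mat"
    by (rule eq_matI) auto
  ultimately show ?thesis
    by (intro similar_matI[where n = ?N and P = "(1 / 2 ^ n) \<cdot>\<^sub>m ?P" and Q = ?P]) (use c in \<open>auto simp: smult_out hadamard_square assoc\<close>)
qed

section \<open>Gaussian elimination on the doubling graph\<close>

text \<open>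
  Each vertex \<open>i > 0\<close> has at most one neighbour above it, namely \<open>2 * i\<close>. Eliminating the vertices in
  decreasing order therefore creates no new entries: the elimination of \<open>2 * i\<close> with pivot
  \<open>d (2 * i)\<close> only changes the diagonal entry at \<open>i\<close>, by \<open>(1/2)\<^sup>2 / d (2 * i)\<close>.
\<close>

lemma char_poly_half_doubling_pivots:
  fixes d :: "nat \<Rightarrow> real"
  assumes d0: "d 0 = x - 1"
    and pivot: "\<And>i. 0 < i \<Longrightarrow> i < N \<Longrightarrow> d i = x - (if 2 * i < N then 1 / (4 * d (2 * i)) else 0)"
    and nz: "\<And>i. 0 < i \<Longrightarrow> i < N \<Longrightarrow> d i \<noteq> 0"
  shows "poly (char_poly (half_doubling_graph N)) x = (\<Prod>i<N. d i)"
proof -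
  define U where "U = mat N N (\<lambda>(i, j). if i = j then 1 else if 0 < i \<and> j = 2 * i then - 1 / (2 * d j) else 0)"
  define R where "R = mat N N (\<lambda>(i, j). if i = j then d i else if 0 < j \<and> i = 2 * j then - 1 / 2 else 0)"
  have U [simp]: "U \<in> carrier_mat N N" and R [simp]: "R \<in> carrier_mat N N"
    by (auto simp: U_def R_def)
  have detU: "det U = 1"
    by (subst det_upper_triangular[of U N]) (auto simp: upper_triangular_def U_def prod_list_diag_prod)
  have detR: "det R = (\<Prod>i<N. d i)"
    by (subst det_lower_triangular[of N R]) (auto simp: R_def prod_list_diag_prod atLeast0LessThan)
  \<comment> \<open>\<open>U\<close> records the elimination steps and \<open>R\<close> is what they leave. Every row of \<open>U\<close> has at most
    two nonzero entries, so the sum for the product has at most two terms.\<close>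
  have "- char_matrix (half_doubling_graph N) x = U * R"
  proof (rule eq_matI)
    fix i j assume "i < dim_row (U * R)" "j < dim_col (U * R)"
    then have ij: "i < N" "j < N" by (auto simp: U_def R_def)
    let ?R = "\<lambda>k. if k = j then d k else if 0 < j \<and> k = 2 * j then - 1 / 2 else 0"
    have "(U * R) $$ (i, j) = (\<Sum>k<N. (if i = k then 1 else if 0 < i \<and> k = 2 * i then - 1 / (2 * d k) else 0) * ?R k)"
      using ij by (simp add: U_def R_def scalar_prod_def atLeast0LessThan)
    also have "\<dots> = (\<Sum>k<N. (if k = i then ?R k else 0) + (if k = 2 * i then if 0 < i then - 1 / (2 * d k) * ?R k else 0 else 0))"
      by (intro sum.cong) auto
    also have "\<dots> = ?R i + (if 2 * i < N \<and> 0 < i then - 1 / (2 * d (2 * i)) * ?R (2 * i) else 0)"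
      using ij by (simp add: sum.distrib)
    also have "\<dots> = (- char_matrix (half_doubling_graph N) x) $$ (i, j)"
      using ij nz[of "2 * i"] pivot[of i] d0
      by (auto simp: char_matrix_def half_doubling_graph_def doubling_mat_def field_simps)
    finally show "(- char_matrix (half_doubling_graph N) x) $$ (i, j) = (U * R) $$ (i, j)" by simp
  qed (auto simp: char_matrix_def half_doubling_graph_def doubling_mat_def U_def R_def)
  then show ?thesis
    by (simp add: char_poly_matrix[OF half_doubling_carrier] det_mult[OF U R] detU detR)
qed

section \<open>Characteristic polynomials of paths\<close>

text \<open>
  The characteristic polynomial of half of the adjacency matrix of a path with \<open>k\<close> vertices; in
  terms of the Chebyshev polynomials of the second kind it is \<open>U\<^sub>k / 2 ^ k\<close>.
\<close>

fun path_poly :: "nat \<Rightarrow> real poly" where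
  "path_poly 0 = 1"
| "path_poly (Suc 0) = [:0, 1:]"
| "path_poly (Suc (Suc k)) = [:0, 1:] * path_poly (Suc k) - Polynomial.smult (1/4) (path_poly k)"

text \<open>
  Makes every pivot nonzero for \<open>x > 1\<close>, which is enough to identify a polynomial. The
  induction needs the stronger claim that each value is more than half of the preceding one.
\<close>

lemma path_poly_pos:
  assumes "x > 1"
  shows "poly (path_poly k) x > 0"
proof -
  have "poly (path_poly k) x > 0 \<and> poly (path_poly (Suc k)) x > poly (path_poly k) x / 2"
  proof (induction k)
    case (Suc k)
    let ?u = "poly (path_poly k) x" and ?v = "poly (path_poly (Suc k)) x"
    have "?v < x * ?v" using Suc assms by simp
    moreover have "poly (path_poly (Suc (Suc k))) x = x * ?v - ?u / 4" by simp
    ultimately show ?case using Suc by linarith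
  qed (use assms in auto)
  then show ?thesis ..
qed

lemma path_poly_monic: "degree (path_poly k) = k \<and> lead_coeff (path_poly k) = 1"
proof (induction k rule: path_poly.induct)
  case (3 k)
  have 1: "[:0, 1:] * path_poly (Suc k) = pCons 0 (path_poly (Suc k))" by simp
  have nz: "path_poly (Suc k) \<noteq> 0" using 3 by auto
  have deg: "degree (path_poly (Suc (Suc k))) = Suc (Suc k)"
    unfolding path_poly.simps 1 using 3 nz
    by (subst diff_conv_add_uminus, subst degree_add_eq_left) (auto simp: degree_pCons_eq)
  have "coeff (path_poly k) (Suc (Suc k)) = 0" using 3 by (intro coeff_eq_0) auto
  then have "lead_coeff (path_poly (Suc (Suc k))) = 1"
    unfolding deg using 3 by (auto simp: coeff_pCons)
  with deg show ?case by blast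
qed auto

lemma path_poly_cos: "2 ^ k * sin t * poly (path_poly k) (cos t) = sin (real (Suc k) * t)"
proof (induction k rule: path_poly.induct)
  case 2
  show ?case using sin_double[of t] by simp
next
  case (3 k)
  let ?u = "real (Suc (Suc k)) * t"
  have e: "real (Suc (Suc (Suc k))) * t = ?u + t" "real (Suc k) * t = ?u - t"
    by (simp_all add: algebra_simps)
  have "2 ^ Suc (Suc k) * sin t * poly (path_poly (Suc (Suc k))) (cos t) =
     2 * cos t * (2 ^ Suc k * sin t * poly (path_poly (Suc k)) (cos t)) - 2 ^ k * sin t * poly (path_poly k) (cos t)"
    by (simp add: algebra_simps)
  also have "\<dots> = 2 * cos t * sin ?u - sin (?u - t)"
    unfolding 3 e by simp
  also have "\<dots> = sin (?u + t)"
    by (simp add: sin_add sin_diff)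
  finally show ?case unfolding e .
qed auto

lemma rational_angle_bounds:
  assumes "0 < p" "p < q"
  shows "0 < real p / real q * pi" "real p / real q * pi < pi"
  using assms mult_strict_right_mono[of "real p / real q" 1 pi] by simp_all

lemma cos_rational_inj:
  assumes "0 < p" "p < q" "0 < p'" "p' < q'"
  shows "cos (real p / real q * pi) = cos (real p' / real q' * pi) \<longleftrightarrow> p * q' = p' * q"
proof -
  have "cos (real p / real q * pi) = cos (real p' / real q' * pi) \<longleftrightarrow> real p / real q * pi = real p' / real q' * pi"
    using cos_inj_pi[of "real p / real q * pi" "real p' / real q' * pi"]
      rational_angle_bounds[OF assms(1,2)] rational_angle_bounds[OF assms(3,4)]
    by (metis less_imp_le)
  also have "\<dots> \<longleftrightarrow> real (p * q') = real (p' * q)"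
    using assms by (simp add: field_simps)
  finally show ?thesis unfolding of_nat_eq_iff .
qed

text \<open>
  At \<open>t = j * pi / (k + 1)\<close> the sine of \<open>(k + 1) * t\<close> vanishes and that of \<open>t\<close> does not. This gives
  \<open>k\<close> different roots of a monic polynomial of degree \<open>k\<close>.
\<close>

lemma path_poly_factors:
  "path_poly k = (\<Prod>j\<in>{1..k}. [:- cos (real j / real (Suc k) * pi), 1:])" (is "_ = ?Q")
proof -
  let ?c = "\<lambda>j. cos (real j / real (Suc k) * pi)"
  have inj: "inj_on ?c {1..k}"
  proof (rule inj_onI)
    fix i j assume "i \<in> {1..k}" "j \<in> {1..k}" "?c i = ?c j"
    then have "i * Suc k = j * Suc k" by (subst (asm) cos_rational_inj) auto
    then show "i = j" by (metis mult_cancel2 nat.distinct(1))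
  qed
  have deg: "degree ?Q = k"
    by (subst degree_prod_eq_sum_degree) auto
  have lc: "lead_coeff ?Q = 1"
    by (simp add: lead_coeff_prod)
  show ?thesis
  proof (rule poly_eqI_degree_lead_coeff[where A = "?c ` {1..k}" and n = k])
    show "coeff (path_poly k) k = coeff ?Q k"
      using path_poly_monic[of k] deg lc by metis
    show "card (?c ` {1..k}) \<ge> k"
      using inj by (simp add: card_image)
    fix z assume "z \<in> ?c ` {1..k}"
    then obtain j where j: "j \<in> {1..k}" "z = ?c j" by auto
    have "sin (real (Suc k) * (real j / real (Suc k) * pi)) = 0"
      by simp
    moreover have "sin (real j / real (Suc k) * pi) > 0"
      using j by (intro sin_gt_zero rational_angle_bounds) auto
    ultimately have "poly (path_poly k) z = 0"
      using path_poly_cos[of k "real j / real (Suc k) * pi"] j(2) by simp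
    moreover have "poly ?Q z = 0"
      using j by (auto simp: poly_prod)
    ultimately show "poly (path_poly k) z = poly ?Q z" by simp
  qed (use path_poly_monic deg in auto)
qed

lemma order_prod:
  fixes f :: "'b \<Rightarrow> 'a :: idom poly"
  assumes "finite S" "\<And>s. s \<in> S \<Longrightarrow> f s \<noteq> 0"
  shows "order x (prod f S) = (\<Sum>s\<in>S. order x (f s))"
  using assms by (induction rule: finite_induct) (auto simp: order_mult)

lemma order_power:
  fixes p :: "'a :: idom poly"
  assumes "p \<noteq> 0"
  shows "order x (p ^ m) = m * order x p"
  using order_prod[of "{..<m}" "\<lambda>_. p" x] assms by simp

lemma path_poly_nonzero [simp]: "path_poly k \<noteq> 0"
  using path_poly_monic[of k] by auto

text \<open>
  In lowest terms \<open>p / q\<close> equals some \<open>j / (k + 1)\<close> exactly if \<open>q\<close> divides \<open>k + 1\<close>, and then for a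
  single \<open>j\<close>.
\<close>

lemma order_path_poly:
  assumes "0 < p" "p < q" "coprime p q"
  shows "order (cos (real p / real q * pi)) (path_poly k) = of_bool (q dvd Suc k)"
proof -
  let ?c = "cos (real p / real q * pi)"
  let ?S = "{j \<in> {1..k}. p * Suc k = j * q}"
  have "order ?c (path_poly k) = (\<Sum>j\<in>{1..k}. order ?c [:- cos (real j / real (Suc k) * pi), 1:])"
    unfolding path_poly_factors[of k] by (rule order_prod) auto
  also have "\<dots> = (\<Sum>j\<in>{1..k}. of_bool (p * Suc k = j * q))"
  proof (intro sum.cong refl)
    fix j assume j: "j \<in> {1..k}"
    have "order ?c [:- cos (real j / real (Suc k) * pi), 1:] = of_bool (?c = cos (real j / real (Suc k) * pi))"
      by (auto simp: order_linear')
    then show "order ?c [:- cos (real j / real (Suc k) * pi), 1:] = of_bool (p * Suc k = j * q)"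
      using j assms by (subst (asm) cos_rational_inj) auto
  qed
  also have "\<dots> = card ({1..k} \<inter> {j. p * Suc k = j * q})"
    by (simp del: mult_Suc_right)
  also have "{1..k} \<inter> {j. p * Suc k = j * q} = ?S" by auto
  also have "card ?S = of_bool (q dvd Suc k)"
  proof (cases "q dvd Suc k")
    case True
    then obtain t where t: "Suc k = q * t" by blast
    then have "0 < t" by (cases t) auto
    then have "p * t < q * t" "0 < p * t" using assms by simp_all
    then have "p * t \<in> {1..k}" unfolding t[symmetric] by simp
    moreover have "p * Suc k = j * q \<longleftrightarrow> j = p * t" for j
    proof -
      have "p * Suc k = (p * t) * q" unfolding t by simp
      then show ?thesis using assms by (metis gr_implies_not0 mult_cancel2)
    qed
    ultimately have "?S = {p * t}" by blast
    with True show ?thesis by simp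
  next
    case False
    have "?S = {}"
    proof (rule ccontr)
      assume "?S \<noteq> {}"
      then have "q dvd p * Suc k" by (metis (mono_tags, lifting) Collect_empty_eq dvd_triv_right)
      with assms False show False by (metis coprime_commute coprime_dvd_mult_right_iff)
    qed
    with False show ?thesis by (simp only: card.empty) simp
  qed
  finally show ?thesis .
qed

section \<open>The characteristic polynomial\<close>

lemma floor_log_less_iff:
  assumes "0 < i"
  shows "floor_log i < n \<longleftrightarrow> i < 2 ^ n"
proof
  assume "floor_log i < n"
  then have "2 ^ Suc (floor_log i) \<le> (2 ^ n :: nat)" by (intro power_increasing) auto
  with floor_log_exp2_gt[of i] show "i < 2 ^ n" by simp
next
  assume "i < 2 ^ n"
  with floor_log_exp2_le[OF assms] have "2 ^ floor_log i < (2 ^ n :: nat)" by linarith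
  then show "floor_log i < n" by simp
qed

lemma prod_floor_log:
  fixes f :: "nat \<Rightarrow> 'a :: comm_monoid_mult"
  shows "(\<Prod>i\<in>{1..<2 ^ n}. f (floor_log i)) = (\<Prod>m<n. f m ^ 2 ^ m)"
proof (induction n)
  case (Suc n)
  have "{1..<2 ^ Suc n} = {1..<2 ^ n} \<union> {2 ^ n..<2 ^ Suc n :: nat}"
    by (auto simp: ivl_disj_un)
  then have "(\<Prod>i\<in>{1..<2 ^ Suc n}. f (floor_log i)) =
      (\<Prod>i\<in>{1..<2 ^ n}. f (floor_log i)) * (\<Prod>i\<in>{2 ^ n..<2 ^ Suc n}. f (floor_log i))"
    by (simp add: prod.union_disjoint)
  also have "(\<Prod>i\<in>{2 ^ n..<2 ^ Suc n}. f (floor_log i)) = (\<Prod>i\<in>{2 ^ n..<2 ^ Suc n :: nat}. f n)"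
    by (intro prod.cong refl arg_cong[of _ _ f] floor_log_eqI) auto
  finally show ?case using Suc by simp
qed simp

text \<open>
  Each \<open>w m\<close> with \<open>0 < m < n\<close> occurs \<open>2 ^ m\<close> times in a numerator and \<open>2 ^ (m - 1)\<close> times in a
  denominator, which leaves \<open>2 ^ (m - 1)\<close>; the factor on the left clears the last denominator.
\<close>

lemma prod_ratio_telescope:
  fixes w :: "nat \<Rightarrow> 'a :: field"
  assumes "\<And>m. w m \<noteq> 0"
  shows "(\<Prod>m<n. (w m / w (Suc m)) ^ 2 ^ m) * w n ^ 2 ^ n = w 0 * (\<Prod>m<n. w (Suc m) ^ 2 ^ m)"
proof (induction n)
  case (Suc n)
  let ?p = "\<Prod>m<n. (w m / w (Suc m)) ^ 2 ^ m"
  have "(\<Prod>m<Suc n. (w m / w (Suc m)) ^ 2 ^ m) * w (Suc n) ^ 2 ^ Suc n =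
      (?p * w n ^ 2 ^ n) * w (Suc n) ^ 2 ^ n"
    using assms by (simp add: power_divide mult_2 power_add)
  then show ?case by (simp add: Suc)
qed simp

text \<open>
  The pivot of a vertex \<open>i > 0\<close> with \<open>h\<close> vertices of its path at or above it is
  \<open>path_poly h / path_poly (h - 1)\<close>; this \<open>h\<close> is \<open>n - floor_log i\<close>. The two sides
  agree at every \<open>x > 1\<close>, hence everywhere. The factor with \<open>k = 0\<close> is \<open>path_poly 0 = 1\<close>.
\<close>

lemma char_poly_half_doubling:
  "char_poly (half_doubling_graph (2 ^ n)) =
     [:-1, 1:] * path_poly n * (\<Prod>k<n. path_poly k ^ 2 ^ (n - 1 - k))" (is "?L = ?R")
proof -
  have "poly ?L x = poly ?R x" if x: "x > 1" for x
  proof -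
    define w where "w m = poly (path_poly (n - m)) x" for m
    define d where "d i = (if i = 0 then x - 1 else w (floor_log i) / w (Suc (floor_log i)))" for i
    have w: "w m > 0" for m
      unfolding w_def using path_poly_pos[OF x] .
    have "poly ?L x = (\<Prod>i<2 ^ n. d i)"
    proof (rule char_poly_half_doubling_pivots)
      fix i :: nat assume i: "0 < i" "i < 2 ^ n"
      show "d i \<noteq> 0" using i w[of "floor_log i"] w[of "Suc (floor_log i)"] by (simp add: d_def)
      show "d i = x - (if 2 * i < 2 ^ n then 1 / (4 * d (2 * i)) else 0)"
      proof (cases "2 * i < 2 ^ n")
        case True
        then have "Suc (floor_log i) < n" using floor_log_less_iff[of "2 * i"] i by simp
        then obtain h where h: "n = Suc (Suc (floor_log i)) + h"
          using less_iff_Suc_add by auto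
        have "d (2 * i) = w (Suc (floor_log i)) / w (Suc (Suc (floor_log i)))"
          using i by (simp add: d_def)
        moreover have "d i = w (floor_log i) / w (Suc (floor_log i))"
          using i by (simp add: d_def)
        moreover have "w (floor_log i) = x * w (Suc (floor_log i)) - w (Suc (Suc (floor_log i))) / 4"
          by (simp add: w_def h)
        ultimately show ?thesis
          using True w[of "Suc (floor_log i)"] w[of "Suc (Suc (floor_log i))"]
          by (simp add: diff_divide_distrib)
      next
        case False
        then have "n = Suc (floor_log i)" using floor_log_less_iff[of "2 * i" n] floor_log_less_iff[of i n] i by simp
        with False i show ?thesis by (simp add: d_def w_def)
      qed
    qed (simp add: d_def)
    also have "{..<2 ^ n} = insert 0 {1..<2 ^ n :: nat}" by auto
    also have "prod d \<dots> = (x - 1) * (\<Prod>i\<in>{1..<2 ^ n}. w (floor_log i) / w (Suc (floor_log i)))"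
      by (simp add: d_def)
    also have "(\<Prod>i\<in>{1..<2 ^ n}. w (floor_log i) / w (Suc (floor_log i))) =
        (\<Prod>m<n. (w m / w (Suc m)) ^ 2 ^ m)"
      by (rule prod_floor_log)
    also have "\<dots> = w 0 * (\<Prod>m<n. w (Suc m) ^ 2 ^ m)"
      using prod_ratio_telescope[of w n] w by (simp add: w_def less_imp_neq[symmetric])
    \<comment> \<open>substitute \<open>k = n - 1 - m\<close>\<close>
    also have "(\<Prod>m<n. w (Suc m) ^ 2 ^ m) = (\<Prod>k<n. poly (path_poly k) x ^ 2 ^ (n - 1 - k))"
      by (subst prod.nat_diff_reindex[symmetric]) (auto simp: w_def intro!: prod.cong)
    finally show ?thesis by (simp add: w_def poly_prod left_diff_distrib)
  qed
  then have "{1<..} \<subseteq> {x. poly (?L - ?R) x = 0}" by auto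
  then have "infinite {x. poly (?L - ?R) x = 0}"
    using infinite_Ioi[of "1 :: real"] finite_subset by blast
  then show ?thesis using poly_roots_finite[of "?L - ?R"] by auto
qed

lemma char_poly_M1:
  "char_poly (M1 n) = [:-1, 1:] * path_poly n * (\<Prod>k<n. path_poly k ^ 2 ^ (n - 1 - k))"
  using char_poly_similar[OF M1_similar] char_poly_half_doubling by simp

section \<open>Spectrum and multiplicities\<close>

lemma complex_root_path_poly:
  "poly (map_poly complex_of_real (path_poly k)) z = 0 \<longleftrightarrow>
     (\<exists>j\<in>{1..k}. z = complex_of_real (cos (real j / real (Suc k) * pi)))"
proof -
  interpret r: map_poly_comm_semiring_hom complex_of_real ..
  show ?thesis
    unfolding path_poly_factors[of k] by (auto simp: r.hom_prod poly_prod)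
qed

lemma Sp_M1:
  "Sp (M1 n) = {1} \<union> {complex_of_real (cos (real p / real q * pi)) |p q :: nat. 1 \<le> p \<and> p < q \<and> q \<le> n + 1}"
proof -
  interpret r: map_poly_comm_semiring_hom complex_of_real ..
  have 1: "z \<in> Sp (M1 n) \<longleftrightarrow> z = 1 \<or> (\<exists>k\<le>n. poly (map_poly complex_of_real (path_poly k)) z = 0)" for z
  proof -
    have "z \<in> Sp (M1 n) \<longleftrightarrow> poly (map_poly complex_of_real (char_poly (M1 n))) z = 0"
      by (simp add: Sp_def spectrum_def eigenvalue_root_char_poly[of _ "2 ^ n"]
          of_real_hom.char_poly_hom[OF M1_carrier])
    also have "\<dots> \<longleftrightarrow> z = 1 \<or> poly (map_poly complex_of_real (path_poly n)) z = 0 \<or>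
        (\<exists>k<n. poly (map_poly complex_of_real (path_poly k)) z = 0)"
      unfolding char_poly_M1 r.hom_mult r.hom_prod r.hom_power
      by (auto simp: poly_prod)
    also have "\<dots> \<longleftrightarrow> z = 1 \<or> (\<exists>k\<le>n. poly (map_poly complex_of_real (path_poly k)) z = 0)"
      by (auto simp: le_less)
    finally show ?thesis .
  qed
  have 2: "(\<exists>k\<le>n. poly (map_poly complex_of_real (path_poly k)) z = 0) \<longleftrightarrow>
      (\<exists>p q :: nat. z = complex_of_real (cos (real p / real q * pi)) \<and> 1 \<le> p \<and> p < q \<and> q \<le> n + 1)"
    (is "?l \<longleftrightarrow> ?r") for z
  proof
    assume ?l
    then obtain k j where "k \<le> n" "j \<in> {1..k}" "z = complex_of_real (cos (real j / real (Suc k) * pi))"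
      unfolding complex_root_path_poly by blast
    then show ?r by (intro exI[of _ j] exI[of _ "Suc k"]) auto
  next
    assume ?r
    then obtain p q :: nat where pq: "z = complex_of_real (cos (real p / real q * pi))" "1 \<le> p" "p < q" "q \<le> n + 1"
      by blast
    then show ?l unfolding complex_root_path_poly
      by (intro exI[of _ "q - 1"] conjI bexI[of _ p]) auto
  qed
  show ?thesis unfolding set_eq_iff 1 2 by simp
qed

lemma eigenvalue_mult_M1:
  assumes "0 < p" "p < q" "coprime p q"
  shows "eigenvalue_mult (M1 n) (cos (real p / real q * pi)) =
    of_bool (q dvd Suc n) + (\<Sum>k<n. 2 ^ (n - 1 - k) * of_bool (q dvd Suc k))"
proof -
  let ?c = "cos (real p / real q * pi)"
  have "?c < cos 0"
    using assms by (intro cos_monotone_0_pi) (auto simp: field_simps)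
  then have "order ?c [:-1, 1:] = 0"
    by (simp add: order_linear')
  then show ?thesis
    unfolding eigenvalue_mult_def char_poly_M1
    using assms by (simp add: order_mult order_prod order_power order_path_poly
        del: mult_pCons_left times_divide_eq_left)
qed

text \<open>
  The geometric sum of \<open>2 ^ (n - m * q)\<close> over the positive multiples \<open>m * q\<close> of \<open>q\<close> up to \<open>n\<close>, in a
  form without division. In the step from \<open>n\<close> to \<open>n + 1\<close> the sum doubles and the multiple \<open>n + 1\<close>
  of \<open>q\<close>, if it is one, adds 1.
\<close>

lemma chain_count:
  fixes q :: nat
  assumes "1 < q"
  shows "(\<Sum>k<n. 2 ^ (n - 1 - k) * of_bool (q dvd Suc k)) * (2 ^ q - 1) = (2 ^ n - 2 ^ (n mod q) :: int)"
proof (induction n)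
  case (Suc n)
  let ?c = "\<lambda>n. (\<Sum>k<n. 2 ^ (n - 1 - k) * of_bool (q dvd Suc k)) :: int"
  have "?c (Suc n) = 2 * ?c n + of_bool (q dvd Suc n)"
  proof -
    have "(\<Sum>k<n. 2 ^ (Suc n - 1 - k) * of_bool (q dvd Suc k) :: int) = (\<Sum>k<n. 2 * (2 ^ (n - 1 - k) * of_bool (q dvd Suc k)))"
      by (intro sum.cong refl) (auto simp flip: power_Suc simp: Suc_diff_Suc)
    then show ?thesis unfolding sum_distrib_left by simp
  qed
  then have "?c (Suc n) * (2 ^ q - 1) = 2 * (?c n * (2 ^ q - 1)) + of_bool (q dvd Suc n) * (2 ^ q - 1)"
    by (simp only: distrib_right mult.assoc)
  also have "\<dots> = 2 * (2 ^ n - 2 ^ (n mod q)) + of_bool (q dvd Suc n) * (2 ^ q - 1)"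
    by (simp only: Suc)
  also have "\<dots> = 2 ^ Suc n - 2 ^ (Suc n mod q)"
  proof (cases "q dvd Suc n")
    case True
    then have "Suc n mod q = 0" by simp
    then have "Suc (n mod q) = q"
      using assms by (simp add: mod_Suc split: if_splits)
    then have "2 ^ q = (2 * 2 ^ (n mod q) :: int)" by (metis power_Suc)
    with True \<open>Suc n mod q = 0\<close> show ?thesis by simp
  next
    case False
    then have "Suc n mod q = Suc (n mod q)"
      by (auto simp: mod_Suc dvd_eq_mod_eq_0)
    with False show ?thesis by simp
  qed
  finally show ?case .
qed simp

text \<open>
  With \<open>s = n mod q\<close>, the geometric quotient equals \<open>c\<close> if the rounding of \<open>n / q\<close> goes down, and
  \<open>c + 2 ^ s / 2 ^ q\<close> if it goes up. In the second case the excess is at most \<open>1/4\<close>, except for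
  \<open>s = q - 1\<close>, that is when \<open>q\<close> divides \<open>n + 1\<close>: there it is \<open>1/2\<close> and the outer rounding goes up.
\<close>

lemma round_chain_count:
  fixes n q :: nat and c :: int
  assumes q: "1 < q" and c: "c * (2 ^ q - 1) = 2 ^ n - 2 ^ (n mod q)"
  shows "round ((2::real) ^ n *
          ((2 powi (- int q) - 2 powi (- int q * (round (real n / real q) + 1))) / (1 - 2 powi (- int q))))
    = c + of_bool (q dvd Suc n)"
proof -
  define r where "r = round (real n / real q)"
  define s where "s = n mod q"
  define f where "f = n div q"
  have n: "n = f * q + s" and s: "s < q" using q by (simp_all add: f_def s_def)
  have pq: "(2::real) ^ q > 1" using q by simp
  have c': "of_int c * (2 ^ q - 1) = (2 ^ n - 2 ^ s :: real)"
    using arg_cong[OF c, of real_of_int] by (simp add: s_def)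
  have e: "(2::real) powi (- int q * (r + 1)) = 2 powi (int n - int q * r) / (2 ^ n * 2 ^ q)"
    by (simp add: power_int_diff power_int_add power_int_minus distrib_left field_simps)
  have E: "(2::real) ^ n * ((2 powi (- int q) - 2 powi (- int q * (r + 1))) / (1 - 2 powi (- int q)))
      = (2 ^ n - 2 powi (int n - int q * r)) / (2 ^ q - 1)" (is "?E = _")
    unfolding e using pq by (simp add: power_int_minus field_simps)
  have "real n / real q = real f + real s / real q"
    using q by (simp add: n field_simps)
  then have r: "r = (if 2 * s < q then int f else int f + 1)"
    unfolding r_def using s q by (intro round_unique) (auto simp: field_simps)
  show ?thesis
  proof (cases "2 * s < q")
    case True
    then have "int n - int q * r = int s" by (simp add: r n)
    then have "?E = of_int c" unfolding E using c' pq by (simp add: field_simps)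
    moreover have "\<not> q dvd Suc n"
      using True q s by (auto simp: n dvd_eq_mod_eq_0 mod_Suc)
    ultimately show ?thesis unfolding r_def by simp
  next
    case False
    then have "int n - int q * r = int s - int q" by (simp add: r n algebra_simps)
    then have "2 powi (int n - int q * r) = (2 ^ s / 2 ^ q :: real)" by (simp add: power_int_diff)
    then have "?E = (of_int c * (2 ^ q - 1) + 2 ^ s / 2 ^ q * (2 ^ q - 1)) / (2 ^ q - 1)"
      unfolding E c' using pq by (simp add: field_simps)
    also have "\<dots> = of_int c + 2 ^ s / 2 ^ q"
      using pq by (simp add: add_divide_distrib)
    finally have E': "?E = of_int c + 2 ^ s / 2 ^ q" .
    show ?thesis
    proof (cases "Suc s = q")
      case True
      then have "Suc n = q * Suc f" by (simp add: n)
      then have "q dvd Suc n" ..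
      moreover have "(2::real) ^ s / 2 ^ q = 1 / 2" by (simp flip: True)
      ultimately show ?thesis using E' unfolding r_def by (intro round_unique) auto
    next
      case False
      then have "Suc (Suc s) \<le> q" using s by simp
      then have "(2::real) ^ Suc (Suc s) \<le> 2 ^ q" by (intro power_increasing) auto
      then have "(2::real) ^ s / 2 ^ q < 1 / 2" using pq by (simp add: field_simps)
      moreover have "\<not> q dvd Suc n" using False s q by (auto simp: n dvd_eq_mod_eq_0 mod_Suc)
      ultimately show ?thesis using E' unfolding r_def by (intro round_unique') auto
    qed
  qed
qed

theorem theorem4p2:
  fixes n :: nat
  shows "Sp (M1 n) = Sp ((1/4) \<cdot>\<^sub>m ((bbs_a0 n + transpose_mat (bbs_a0 n)) + (bbs_a1 n + transpose_mat (bbs_a1 n))))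
    \<and> Sp (M1 n) = {1} \<union> {complex_of_real (cos (real p / real q * pi)) |p q :: nat. 1 \<le> p \<and> p < q \<and> q \<le> n + 1}
    \<and> (\<forall>p q :: nat. 1 \<le> p \<and> p < q \<and> q \<le> n + 1 \<and> coprime p q \<longrightarrow>
      int (eigenvalue_mult (M1 n) (cos (real p / real q * pi))) =
        round ((2::real) ^ n *
          ((2 powi (- int q) - 2 powi (- int q * (round (real n / real q) + 1))) / (1 - 2 powi (- int q)))))"
proof (intro conjI allI impI)
  have "bbs_a0 n + transpose_mat (bbs_a0 n) + bbs_a1 n + transpose_mat (bbs_a1 n) =
      (bbs_a0 n + transpose_mat (bbs_a0 n)) + (bbs_a1 n + transpose_mat (bbs_a1 n))"
    by (rule assoc_add_mat[of _ "2 ^ n" "2 ^ n"]) auto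
  then show "Sp (M1 n) = Sp ((1/4) \<cdot>\<^sub>m ((bbs_a0 n + transpose_mat (bbs_a0 n)) + (bbs_a1 n + transpose_mat (bbs_a1 n))))"
    by (simp add: M1_def)
  show "Sp (M1 n) = {1} \<union> {complex_of_real (cos (real p / real q * pi)) |p q :: nat. 1 \<le> p \<and> p < q \<and> q \<le> n + 1}"
    by (rule Sp_M1)
next
  fix p q :: nat
  assume pq: "1 \<le> p \<and> p < q \<and> q \<le> n + 1 \<and> coprime p q"
  then have q: "1 < q" by linarith
  have "int (eigenvalue_mult (M1 n) (cos (real p / real q * pi))) =
      (\<Sum>k<n. 2 ^ (n - 1 - k) * of_bool (q dvd Suc k)) + of_bool (q dvd Suc n)"
    using pq by (subst eigenvalue_mult_M1) simp_all
  then show "int (eigenvalue_mult (M1 n) (cos (real p / real q * pi))) =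
        round ((2::real) ^ n *
          ((2 powi (- int q) - 2 powi (- int q * (round (real n / real q) + 1))) / (1 - 2 powi (- int q))))"
    unfolding round_chain_count[OF q chain_count[OF q]] .
qed

end
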